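(* Let $p,q\in L^2([0,1],\mathbb{R})$ and let $v(x)=(a(x),b(x))^T$ be the first column of the coefficient matrix $K_0^C(x)$, i.e. $a(x)=K_{11}^{(0)}(x)$, $b(x)=K_{21}^{(0)}(x)$. Then the potential $Q$ can be recovered from the equality, valid for almost every $x\in[0,1]$, $$\begin{pmatrix}p\\ q\end{pmatrix}=\frac1{4b^2+(1+2a)^2}\begin{pmatrix}-2b&-(1+2a)\\ 1+2a&-2b\end{pmatrix}\begin{pmatrix}2a'\\ 2b'\end{pmatrix}=\frac2{4b^2+(1+2a)^2}\begin{pmatrix}-2(ab)'-b'\\ (a^2)'-(b^2)'+a'\end{pmatrix}.$$
   Context: Let $B=\begin{pmatrix}0&1\\ -1&0\end{pmatrix}$ and $Q(x)=\begin{pmatrix}p(x)&q(x)\\ q(x)&-p(x)\end{pmatrix}$. $P_n$ is the $n$-th Legendre polynomial and $\mathcal{M}_2$ the space of $2\times2$ complex matrices. It is known that there is a matrix-valued kernel $K(x,t)$ with $K(x,\cdot)\in L^2([-x,x],\mathcal{M}_2)$ such that the matrix solution $U(\lambda,x)$ of $BU'+QU=\lambda U$ on $[0,1]$, $U(\lambda,0)=I$, is $U(\lambda,x)=e^{-B\lambda x}+\int_{-x}^xK(x,t)e^{-B\lambda t}dt$ for all $\lambda\in\mathbb{C}$. For $x>0$ write $K(x,t)=\sum_{n=0}^\infty\frac1xK_n(x)P_n(t/x)$ (convergent in $L^2((-x,x),\mathcal{M}_2)$), $K_n(x)=\left(K_{ij}^{(n)}(x)\right)_{i,j=1}^2$,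 i.e. $K_n(x)=\frac{2n+1}{2}\int_{-x}^xK(x,t)P_n(t/x)\,dt$. Then $K_n^C(x)=\begin{pmatrix}K_{11}^{(2n)}(x)&K_{12}^{(2n+1)}(x)\\ K_{21}^{(2n)}(x)&K_{22}^{(2n+1)}(x)\end{pmatrix}$. *)

theory Defs
  imports "HOL-Analysis.Analysis" "HOL-Computational_Algebra.Polynomial"
begin

text \<open>
  \<open>\<M>\<^sub>2\<close> is the type \<open>complex^2^2\<close>, with product \<open>**\<close>, unit \<open>mat 1\<close> and, for
  complex \<open>c\<close>, scalar multiplication \<open>mat c ** A\<close>. Note that \<open>*\<close>, \<open>1\<close> and \<open>^\<close> on this type
  are entrywise and are not used here.
\<close>

type_synonym M2 = "complex^2^2"

definition L2_on :: "real set \<Rightarrow> (real \<Rightarrow> 'a::euclidean_space) \<Rightarrow> bool" where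
  "L2_on S f \<longleftrightarrow> f \<in> borel_measurable (lebesgue_on S)
      \<and> integrable (lebesgue_on S) (\<lambda>t. (norm (f t))\<^sup>2)"

text \<open>
  The usual epsilon-delta definition. A finite family of non-overlapping closed intervals
  is a division of its union.
\<close>

definition absolutely_continuous_on :: "real set \<Rightarrow> (real \<Rightarrow> 'a::real_normed_vector) \<Rightarrow> bool" where
  "absolutely_continuous_on S f \<longleftrightarrow>
    (\<forall>\<epsilon>>0. \<exists>\<delta>>0. \<forall>D. D division_of \<Union>D \<and> \<Union>D \<subseteq> S \<and> (\<Sum>J\<in>D. Sup J - Inf J) < \<delta> \<longrightarrow>
       (\<Sum>J\<in>D. norm (f (Sup J) - f (Inf J))) < \<epsilon>)"

definition Bmat :: M2 where
  "Bmat = vector [vector [0, 1], vector [-1, 0]]"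

definition Qmat :: "(real \<Rightarrow> real) \<Rightarrow> (real \<Rightarrow> real) \<Rightarrow> real \<Rightarrow> M2" where
  "Qmat p q x = vector [vector [of_real (p x), of_real (q x)],
                        vector [of_real (q x), - of_real (p x)]]"

definition mexp :: "complex^'n^'n \<Rightarrow> complex^'n^'n" where
  "mexp A = (\<Sum>n. (1 / fact n) *\<^sub>R (((**) A ^^ n) (mat 1)))"

lemma mexp_B: "mexp (mat (- c) ** Bmat) = vector [vector [cos c, - sin c], vector [sin c, cos c]]"
proof -
  have M: "mat (-c) ** Bmat = vector [vector [0, -c], vector [c, 0]]"
    by (simp add: matrix_matrix_mult_def vec_eq_iff mat_def Bmat_def sum_2 forall_2)
  have P: "((**) (vector [vector [0, -c], vector [c, 0]] :: M2) ^^ n) (mat 1) =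
     (let e = (if even n then (-1)^(n div 2) * c^n else 0); d = (if odd n then (-1)^(n div 2) * c^n else 0)
      in vector [vector [e, - d], vector [d, e]])" for n
  proof (induction n)
    case 0 then show ?case by (simp add: vec_eq_iff mat_def forall_2)
  next
    case (Suc n) then show ?case
      by (auto simp: Let_def matrix_matrix_mult_def vec_eq_iff sum_2 forall_2 elim!: evenE oddE)
  qed
  have c1: "(\<lambda>n. cos_coeff n *\<^sub>R c ^ n) sums cos c" by (rule cos_converges)
  have s1: "(\<lambda>n. sin_coeff n *\<^sub>R c ^ n) sums sin c" by (rule sin_converges)
  have E: "(1 / fact n) *\<^sub>R (((**) (vector [vector [0, -c], vector [c, 0]] :: M2) ^^ n) (mat 1))
     = (vector [vector [cos_coeff n *\<^sub>R c ^ n, - (sin_coeff n *\<^sub>R c ^ n)], vector [sin_coeff n *\<^sub>R c ^ n, cos_coeff n *\<^sub>R c ^ n]] :: M2)" for n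
    unfolding P unfolding Let_def vec_eq_iff forall_2 vector_scaleR_component vector_2 by (auto simp: cos_coeff_def sin_coeff_def scaleR_conv_of_real elim!: evenE oddE)
  have "(\<lambda>n. (vector [vector [cos_coeff n *\<^sub>R c ^ n, - (sin_coeff n *\<^sub>R c ^ n)], vector [sin_coeff n *\<^sub>R c ^ n, cos_coeff n *\<^sub>R c ^ n]] :: M2)) sums vector [vector [cos c, - sin c], vector [sin c, cos c]]"
    unfolding sums_def
    apply (rule vec_tendstoI, rule vec_tendstoI)
    subgoal for i j using c1 s1 sums_minus[OF s1] exhaust_2[of i] exhaust_2[of j] by (auto simp: sums_def sum_component)
    done
  then show ?thesis unfolding M mexp_def E by (simp add: sums_iff)
qed

text \<open>
  Since \<open>Q\<close> is only square integrable, \<open>B U' + Q U = \<lambda> U\<close> is understood in the sense of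
  Caratheodory: \<open>U\<close> is absolutely continuous and satisfies the equation almost everywhere.
  Derivatives are relative to \<open>[0,1]\<close>, so values outside the interval are irrelevant.
\<close>

definition matrix_solution ::
  "(real \<Rightarrow> real) \<Rightarrow> (real \<Rightarrow> real) \<Rightarrow> complex \<Rightarrow> (real \<Rightarrow> M2) \<Rightarrow> bool" where
  "matrix_solution p q lam U \<longleftrightarrow>
     absolutely_continuous_on {0..1} U \<and> U 0 = mat 1 \<and>
     (AE x in lebesgue_on {0..1}. \<exists>U'. (U has_vector_derivative U') (at x within {0..1}) \<and>
        Bmat ** U' + Qmat p q x ** U x = mat lam ** U x)"

definition transmutation_kernel ::
  "(complex \<Rightarrow> real \<Rightarrow> M2) \<Rightarrow> (real \<Rightarrow> real \<Rightarrow> M2) \<Rightarrow> bool" where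
  "transmutation_kernel U K \<longleftrightarrow>
     (\<forall>x\<in>{0..1}. L2_on {-x..x} (K x)) \<and>
     (\<forall>lam. \<forall>x\<in>{0..1}. U lam x = mexp (mat (- (lam * of_real x)) ** Bmat)
        + (LINT t|lebesgue_on {-x..x}. K x t ** mexp (mat (- (lam * of_real t)) ** Bmat)))"

text \<open>Legendre polynomials, by Rodrigues' formula \<open>P\<^sub>n = (1 / (2^n n!)) (d/dx)^n (x\<^sup>2 - 1)^n\<close>.\<close>

definition legendre_poly :: "nat \<Rightarrow> real poly" where
  "legendre_poly n = smult (1 / (2 ^ n * fact n)) ((pderiv ^^ n) ([:-1, 0, 1:] ^ n))"

lemma legendre_poly_0: "legendre_poly 0 = 1"
  by (simp add: legendre_poly_def)

text \<open>
  The Fourier--Legendre coefficients \<open>K\<^sub>n(x)\<close> of \<open>K(x,t) = (\<Sum>n. K\<^sub>n(x) P\<^sub>n(t/x) / x)\<close>.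
  At \<open>x = 0\<close> the value is \<open>0\<close>, as the integral is over a null set.
\<close>

definition kernel_coeff :: "(real \<Rightarrow> real \<Rightarrow> M2) \<Rightarrow> nat \<Rightarrow> real \<Rightarrow> M2" where
  "kernel_coeff K n x = ((2 * real n + 1) / 2) *\<^sub>R
     (LINT t|lebesgue_on {-x..x}. poly (legendre_poly n) (t / x) *\<^sub>R K x t)"

definition kernel_coeff_C :: "(real \<Rightarrow> real \<Rightarrow> M2) \<Rightarrow> nat \<Rightarrow> real \<Rightarrow> M2" where
  "kernel_coeff_C K n x = vector
     [vector [kernel_coeff K (2*n) x $ 1 $ 1, kernel_coeff K (2*n+1) x $ 1 $ 2],
      vector [kernel_coeff K (2*n) x $ 2 $ 1, kernel_coeff K (2*n+1) x $ 2 $ 2]]"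

end

theory Submission
  imports Defs
begin

text \<open>
  At \<open>\<lambda> = 0\<close> the exponentials in the integral representation of \<open>U(\<lambda>,x)\<close> are the identity, so
  the zero-energy solution is \<open>U(0,x) = I + 2 K\<^sub>0(x)\<close>: the zeroth Legendre coefficient is half the
  integral of the kernel (\<open>zero_energy_kernel_coeff\<close>). Its first column is therefore
  \<open>(y\<^sub>1, y\<^sub>2) = (1 + 2a, 2b)\<close>, and the differential equation says
  \<open>y\<^sub>1' = q y\<^sub>1 - p y\<^sub>2\<close> and \<open>y\<^sub>2' = - p y\<^sub>1 - q y\<^sub>2\<close>. Read as equations for \<open>p\<close> and \<open>q\<close> this is a
  linear system of determinant \<open>y\<^sub>1\<^sup>2 + y\<^sub>2\<^sup>2\<close>, and Cramer's rule is the recovery formula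
  (\<open>potential_from_derivatives\<close>).

  The one analytic point is that the determinant never vanishes. As \<open>U\<close> takes complex values this
  needs both that \<open>y\<^sub>1, y\<^sub>2\<close> are real and that they have no common zero. Since \<open>p\<close> and \<open>q\<close> are real,
  the pair of real parts and the pair of imaginary parts of \<open>(y\<^sub>1, y\<^sub>2)\<close> solve the system
  separately, and a solution that vanishes at one point vanishes identically. For the imaginary
  parts, which vanish at \<open>0\<close>, this gives reality; for the real parts, which are \<open>(1, 0)\<close> at \<open>0\<close>, it
  excludes any zero.

  This uniqueness holds although the coefficients are merely integrable and the equation holds only
  almost everywhere. It rests on the fundamental theorem of calculus for absolutely continuous
  functions, which is proved directly with gauges: outside the exceptional null set the gauge comes
  from differentiability, and on that set it is an open cover so small that absolute continuity
  controls the increments of the function there.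
\<close>

section \<open>Absolutely continuous functions\<close>

lemma absolutely_continuous_onE:
  assumes "absolutely_continuous_on S f" and "\<epsilon> > 0"
  obtains \<delta> where "\<delta> > 0"
    "\<forall>D. D division_of \<Union>D \<and> \<Union>D \<subseteq> S \<and> (\<Sum>J\<in>D. Sup J - Inf J) < \<delta> \<longrightarrow>
       (\<Sum>J\<in>D. norm (f (Sup J) - f (Inf J))) < \<epsilon>"
  using assms(1)[unfolded absolutely_continuous_on_def, rule_format, OF assms(2)]
  by (elim exE conjE) (rule that)

lemma absolutely_continuous_on_subset:
  assumes "absolutely_continuous_on S f" and "T \<subseteq> S"
  shows "absolutely_continuous_on T f"
  unfolding absolutely_continuous_on_def
proof (intro allI impI)
  fix \<epsilon> :: real assume "\<epsilon> > 0"
  obtain \<delta> where "\<delta> > 0"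
    "\<forall>D. D division_of \<Union>D \<and> \<Union>D \<subseteq> S \<and> (\<Sum>J\<in>D. Sup J - Inf J) < \<delta> \<longrightarrow>
       (\<Sum>J\<in>D. norm (f (Sup J) - f (Inf J))) < \<epsilon>"
    by (rule absolutely_continuous_onE[OF assms(1) \<open>\<epsilon> > 0\<close>])
  from this assms(2) show "\<exists>\<delta>>0. \<forall>D. D division_of \<Union>D \<and> \<Union>D \<subseteq> T \<and> (\<Sum>J\<in>D. Sup J - Inf J) < \<delta> \<longrightarrow>
       (\<Sum>J\<in>D. norm (f (Sup J) - f (Inf J))) < \<epsilon>"
    by (intro exI[of _ \<delta>]) (auto intro: order_trans)
qed

lemma absolutely_continuous_on_bounded_linear:
  assumes L: "bounded_linear L" and f: "absolutely_continuous_on S f"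
  shows "absolutely_continuous_on S (\<lambda>x. L (f x))"
  unfolding absolutely_continuous_on_def
proof (intro allI impI)
  fix \<epsilon> :: real assume e: "\<epsilon> > 0"
  obtain C where C: "C > 0" "\<And>x. norm (L x) \<le> norm x * C"
    using bounded_linear.pos_bounded[OF L] by (elim exE conjE) simp
  obtain \<delta> where d: "\<delta> > 0"
    "\<forall>D. D division_of \<Union>D \<and> \<Union>D \<subseteq> S \<and> (\<Sum>J\<in>D. Sup J - Inf J) < \<delta> \<longrightarrow>
       (\<Sum>J\<in>D. norm (f (Sup J) - f (Inf J))) < \<epsilon> / C"
    by (rule absolutely_continuous_onE[OF f divide_pos_pos[OF e C(1)]])
  have "(\<Sum>J\<in>D. norm (L (f (Sup J)) - L (f (Inf J)))) < \<epsilon>"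
    if "D division_of \<Union>D" "\<Union>D \<subseteq> S" "(\<Sum>J\<in>D. Sup J - Inf J) < \<delta>" for D
  proof -
    have "(\<Sum>J\<in>D. norm (L (f (Sup J)) - L (f (Inf J)))) \<le> (\<Sum>J\<in>D. norm (f (Sup J) - f (Inf J)) * C)"
      by (intro sum_mono) (metis C(2) bounded_linear.linear[OF L] linear_diff)
    also have "\<dots> < \<epsilon>"
      using d(2)[rule_format, of D] that C(1) by (simp add: sum_distrib_right[symmetric] pos_less_divide_eq)
    finally show ?thesis .
  qed
  with d(1) show "\<exists>\<delta>>0. \<forall>D. D division_of \<Union>D \<and> \<Union>D \<subseteq> S \<and> (\<Sum>J\<in>D. Sup J - Inf J) < \<delta> \<longrightarrow>
       (\<Sum>J\<in>D. norm (L (f (Sup J)) - L (f (Inf J)))) < \<epsilon>"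
    by (intro exI[of _ \<delta>]) simp
qed

text \<open>
  This turns the smallness condition of absolute continuity, on the total length of a family of
  intervals, into one on the measure of an open set that contains them.
\<close>

lemma sum_lengths_division_le_measure:
  fixes D :: "real set set"
  assumes D: "D division_of \<Union>D" and T: "\<Union>D \<subseteq> T" "T \<in> lmeasurable"
  shows "(\<Sum>J\<in>D. Sup J - Inf J) \<le> measure lebesgue T"
proof -
  have "(\<Sum>J\<in>D. Sup J - Inf J) = (\<Sum>J\<in>D. measure lebesgue J)"
  proof (rule sum.cong[OF refl])
    fix J assume "J \<in> D"
    then obtain c d where "J = cbox c d" "J \<noteq> {}"
      using division_ofD(3,4)[OF D] by blast
    then show "Sup J - Inf J = measure lebesgue J" by auto
  qed
  also have "\<dots> = measure lebesgue (\<Union>D)"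
    using content_division[OF D] by simp
  also have "\<dots> \<le> measure lebesgue T"
    using T D by (intro measure_mono_fmeasurable) (auto intro!: fmeasurableD lmeasurable_compact compact_Union dest: division_ofD)
  finally show ?thesis .
qed

text \<open>
  A difference quotient across the tag of an interval is as good as a one-sided one, because the
  two errors at the endpoints add up to a multiple of the whole length.
\<close>

lemma has_derivative_straddle:
  fixes f :: "real \<Rightarrow> 'a::real_normed_vector"
  assumes "norm (f u - f x - (u - x) *\<^sub>R y) \<le> e * \<bar>u - x\<bar>" "norm (f v - f x - (v - x) *\<^sub>R y) \<le> e * \<bar>v - x\<bar>"
    and "u \<le> x" "x \<le> v"
  shows "norm ((v - u) *\<^sub>R y - (f v - f u)) \<le> e * (v - u)"
proof -
  have "norm ((v - u) *\<^sub>R y - (f v - f u)) = norm (f u - f x - (u - x) *\<^sub>R y - (f v - f x - (v - x) *\<^sub>R y))"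
    by (auto simp: algebra_simps)
  also have "\<dots> \<le> norm (f u - f x - (u - x) *\<^sub>R y) + norm (f v - f x - (v - x) *\<^sub>R y)"
    by (rule norm_triangle_ineq4)
  also have "\<dots> \<le> e * (v - u)"
    using assms by (simp add: algebra_simps)
  finally show ?thesis .
qed

text \<open>
  The integral is the gauge integral, so existence and value of the integral both come out of one
  estimate of the Riemann sums. For a fine tagged division, intervals tagged outside \<open>E\<close> contribute an error proportional to their length. Those
  tagged in \<open>E\<close> lie in an open set of small measure, and there the integrand may be taken to be
  \<open>0\<close>, so that their error is the sum of the increments of \<open>f\<close>, which absolute continuity bounds.
\<close>

theorem fundamental_theorem_of_calculus_absolutely_continuous:
  fixes f :: "real \<Rightarrow> 'a::banach"
  assumes ab: "a \<le> b" and ac: "absolutely_continuous_on {a..b} f" and E: "negligible E"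
    and vecd: "\<And>x. x \<in> {a..b} - E \<Longrightarrow> (f has_vector_derivative f' x) (at x within {a..b})"
  shows "(f' has_integral (f b - f a)) {a..b}"
proof -
  define g where "g x = (if x \<in> E then 0 else f' x)" for x
  have "(g has_integral (f b - f a)) {a..b}"
    unfolding has_integral_real
  proof (intro allI impI)
    fix \<epsilon> :: real assume e: "\<epsilon> > 0"
    define \<eta> where "\<eta> = \<epsilon> / (2 * (b - a + 1))"
    have eta: "\<eta> > 0" using e ab by (simp add: \<eta>_def)
    have eta2: "\<eta> * (b - a) \<le> \<epsilon> / 2" using e ab by (simp add: \<eta>_def field_simps)
    obtain \<delta> where d: "\<delta> > 0"
      "\<forall>D. D division_of \<Union>D \<and> \<Union>D \<subseteq> {a..b} \<and> (\<Sum>J\<in>D. Sup J - Inf J) < \<delta> \<longrightarrow>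
       (\<Sum>J\<in>D. norm (f (Sup J) - f (Inf J))) < \<epsilon> / 2"
      by (rule absolutely_continuous_onE[OF ac half_gt_zero[OF e]])
    have E': "E \<in> sets lebesgue" "emeasure lebesgue E = 0"
      using E by (auto simp: negligible_iff_null_sets)
    obtain T where T: "open T" "E \<subseteq> T" "T \<in> lmeasurable" "measure lebesgue T < \<delta>"
    proof -
      obtain T where T: "open T" "E \<subseteq> T" "T - E \<in> lmeasurable" "emeasure lebesgue (T - E) < ennreal \<delta>"
        using sets_lebesgue_outer_open[OF E'(1) d(1)] by blast
      have TE: "T = (T - E) \<union> E" using T by blast
      have lm: "T \<in> lmeasurable"
        using fmeasurable.Un[OF T(3), of E] E TE by (simp add: negligible_iff_measure)
      have "emeasure lebesgue T = emeasure lebesgue (T - E)"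
        using E E' T lm by (simp add: emeasure_Diff_null_set negligible_iff_null_sets fmeasurableD)
      with T lm have "ennreal (measure lebesgue T) < ennreal \<delta>"
        by (simp add: emeasure_eq_measure2)
      then show ?thesis
        using that[OF T(1,2) lm] by (simp add: ennreal_less_iff)
    qed
    have "\<forall>x. \<exists>r>0. x \<in> {a..b} - E \<longrightarrow>
           (\<forall>y\<in>{a..b}. norm (y-x) < r \<longrightarrow> norm (f y - f x - (y-x) *\<^sub>R f' x) \<le> \<eta> * norm (y-x))"
      using vecd[unfolded has_vector_derivative_def has_derivative_within_alt] eta
      by (metis (no_types, lifting) zero_less_one)
    then obtain r where r: "\<And>x. 0 < r x"
        "\<And>x y. \<lbrakk>x \<in> {a..b} - E; y \<in> {a..b}; norm (y-x) < r x\<rbrakk>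
           \<Longrightarrow> norm (f y - f x - (y-x) *\<^sub>R f' x) \<le> \<eta> * norm (y-x)"
      by metis
    define \<gamma> where "\<gamma> x = (if x \<in> E then T else ball x (r x))" for x
    have gauge: "gauge \<gamma>"
      using T r(1) by (auto simp: gauge_def \<gamma>_def)
    have riemann: "norm ((\<Sum>(x,k)\<in>p. measure lborel k *\<^sub>R g x) - (f b - f a)) < \<epsilon>"
      if p: "p tagged_division_of {a..b}" and fine: "\<gamma> fine p" for p
    proof -
      have fin: "finite p" using p by blast
      have K: "x \<in> K \<and> K \<subseteq> {a..b} \<and> K \<subseteq> \<gamma> x \<and> (\<exists>u v. K = {u..v} \<and> u \<le> v)" if xK: "(x,K) \<in> p" for x K
      proof -
        obtain u v where "K = cbox u v" "x \<in> K" "K \<subseteq> {a..b}"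
          using tagged_division_ofD(2-4)[OF p xK] by blast
        then show ?thesis using fineD[OF fine xK] by auto
      qed
      define d' where "d' = (\<lambda>(x,K). measure lborel K *\<^sub>R g x - (f (Sup K) - f (Inf K)))"
      define pE where "pE = p \<inter> {t. fst t \<in> E}"
      have split: "sum d' p = sum d' pE + sum d' (p - pE)"
        using fin sum.subset_diff[of pE p d'] by (simp add: pE_def add.commute)
      have "norm (sum d' (p - pE)) \<le> (\<Sum>(x,K)\<in>p - pE. \<eta> * (Sup K - Inf K))"
      proof (rule sum_norm_le, safe)
        fix x K assume xK: "(x,K) \<in> p" "(x,K) \<notin> pE"
        then have xE: "x \<notin> E" by (auto simp: pE_def)
        obtain u v where uv: "K = {u..v}" "u \<le> v" "u \<le> x" "x \<le> v" "a \<le> u" "v \<le> b" "K \<subseteq> ball x (r x)"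
          using K[OF xK(1)] xE by (auto simp: \<gamma>_def)
        then have "u \<in> K" "v \<in> K" by auto
        then have "u \<in> ball x (r x)" "v \<in> ball x (r x)" using uv(7) by blast+
        then have "norm ((v - u) *\<^sub>R f' x - (f v - f u)) \<le> \<eta> * (v - u)"
          using uv xE by (intro has_derivative_straddle[where x = x] r(2)[unfolded real_norm_def])
            (auto simp: dist_real_def)
        then show "norm (d' (x,K)) \<le> \<eta> * (Sup K - Inf K)"
          using uv xE by (simp add: d'_def g_def)
      qed
      also have "\<dots> \<le> (\<Sum>(x,K)\<in>p. \<eta> * (Sup K - Inf K))"
      proof (rule sum_mono2[OF fin])
        fix z assume "z \<in> p - (p - pE)"
        then have "(fst z, snd z) \<in> p" by simp
        then obtain u v where "snd z = {u..v}" "u \<le> v" using K by blast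
        then show "0 \<le> (case z of (x,K) \<Rightarrow> \<eta> * (Sup K - Inf K))"
          using eta by (simp add: split_def)
      qed simp
      also have "\<dots> = \<eta> * (\<Sum>(x,K)\<in>p. Sup K - Inf K)"
        by (simp add: sum_distrib_left split_def)
      also have "\<dots> \<le> \<epsilon> / 2"
        using additive_tagged_division_1[OF ab p, of "\<lambda>x. x"] eta2 by simp
      finally have good: "norm (sum d' (p - pE)) \<le> \<epsilon> / 2" .
      have pE: "pE tagged_partial_division_of {a..b}"
        using p unfolding pE_def by (meson inf_le1 tagged_division_of_def tagged_partial_division_subset)
      define D where "D = snd ` pE"
      have D: "D division_of \<Union>D"
        unfolding D_def by (rule partial_division_of_tagged_division[OF pE])
      have "J \<subseteq> {a..b} \<and> J \<subseteq> T" if "J \<in> D" for J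
      proof -
        obtain x where x: "(x,J) \<in> p" "x \<in> E"
          using \<open>J \<in> D\<close> by (auto simp: D_def pE_def)
        then show ?thesis using K[OF x(1)] by (simp add: \<gamma>_def)
      qed
      then have "\<Union>D \<subseteq> {a..b}" "\<Union>D \<subseteq> T" by blast+
      moreover have "(\<Sum>J\<in>D. Sup J - Inf J) < \<delta>"
        using sum_lengths_division_le_measure[OF D \<open>\<Union>D \<subseteq> T\<close> T(3)] T(4) by linarith
      ultimately have small: "(\<Sum>J\<in>D. norm (f (Sup J) - f (Inf J))) < \<epsilon> / 2"
        using d(2)[rule_format, of D] D by simp
      have "norm (sum d' pE) \<le> (\<Sum>(x,J)\<in>pE. norm (f (Sup J) - f (Inf J)))"
        by (rule sum_norm_le) (auto simp: pE_def d'_def g_def norm_minus_commute)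
      \<comment> \<open>Passing from tagged intervals to the set of intervals merges equal ones. These are degenerate,
        so a zero value on empty and one-point intervals makes the sums agree; the empty
        interval does not occur, and its value is only set to fit the lemma.\<close>
      also have "\<dots> = (\<Sum>(x,J)\<in>pE. if J = {} then 0 else norm (f (Sup J) - f (Inf J)))"
      proof (rule sum.cong[OF refl])
        fix z assume "z \<in> pE"
        then have "(fst z, snd z) \<in> p" by (simp add: pE_def)
        then have "snd z \<noteq> {}" using K by blast
        then show "(case z of (x,J) \<Rightarrow> norm (f (Sup J) - f (Inf J))) =
            (case z of (x,J) \<Rightarrow> if J = {} then 0 else norm (f (Sup J) - f (Inf J)))"
          by (simp add: split_def)
      qed
      also have "\<dots> = (\<Sum>J\<in>D. if J = {} then 0 else norm (f (Sup J) - f (Inf J)))"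
        unfolding D_def
        by (rule sum.over_tagged_division_lemma[OF tagged_partial_division_of_Union_self[OF pE]])
           (auto simp: not_less)
      also have "\<dots> = (\<Sum>J\<in>D. norm (f (Sup J) - f (Inf J)))"
        using division_ofD(3)[OF D] by (intro sum.cong) auto
      finally have bad: "norm (sum d' pE) < \<epsilon> / 2" using small by simp
      have "(\<Sum>(x,k)\<in>p. measure lborel k *\<^sub>R g x) - (f b - f a) = sum d' p"
        using additive_tagged_division_1[OF ab p, of f]
        by (simp add: d'_def split_def sum_subtractf)
      then show ?thesis
        using split good bad norm_triangle_ineq[of "sum d' pE" "sum d' (p - pE)"] by simp
    qed
    show "\<exists>\<gamma>. gauge \<gamma> \<and> (\<forall>\<D>. \<D> tagged_division_of {a..b} \<and> \<gamma> fine \<D> \<longrightarrow>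
        norm ((\<Sum>(x,k)\<in>\<D>. measure lborel k *\<^sub>R g x) - (f b - f a)) < \<epsilon>)"
      by (intro exI[of _ \<gamma>] conjI allI impI gauge riemann) simp_all
  qed
  then show ?thesis
    by (rule has_integral_spike[OF E, rotated]) (simp add: g_def)
qed

section \<open>Uniqueness for linear equations with integrable coefficients\<close>

text \<open>
  The zero set of \<open>u\<close> is closed in the interval. It is also open: near a zero \<open>x\<close>, on an interval so
  short that \<open>c\<close> has integral below \<open>1/2\<close>, the maximum \<open>M\<close> of \<open>norm u\<close> is at most \<open>M/2\<close>, because
  \<open>u\<close> grows from \<open>0\<close> by at most the integral of \<open>c M\<close>. Connectedness then replaces Gronwall's
  inequality, and it covers points on both sides of the zero at once.
\<close>

lemma absolutely_continuous_linear_differential_inequality_zero: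
  fixes u :: "real \<Rightarrow> 'a::banach" and c :: "real \<Rightarrow> real"
  assumes ac: "absolutely_continuous_on {a..b} u" and E: "negligible E"
    and vecd: "\<And>x. x \<in> {a..b} - E \<Longrightarrow> (u has_vector_derivative u' x) (at x within {a..b})"
    and bound: "\<And>x. x \<in> {a..b} - E \<Longrightarrow> norm (u' x) \<le> c x * norm (u x)"
    and c: "c integrable_on {a..b}" "\<And>x. x \<in> {a..b} \<Longrightarrow> 0 \<le> c x"
    and s: "s \<in> {a..b}" "u s = 0" and t: "t \<in> {a..b}"
  shows "u t = 0"
proof -
  define h where "h x = (if x \<in> E then 0 else u' x)" for x
  define F where "F x = integral {a..x} c" for x
  have ftc: "(h has_integral (u \<beta> - u \<alpha>)) {\<alpha>..\<beta>}" if "a \<le> \<alpha>" "\<alpha> \<le> \<beta>" "\<beta> \<le> b" for \<alpha> \<beta>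
  proof (rule fundamental_theorem_of_calculus_absolutely_continuous[OF that(2) _ E])
    show "absolutely_continuous_on {\<alpha>..\<beta>} u"
      using that by (intro absolutely_continuous_on_subset[OF ac]) auto
    show "(u has_vector_derivative h x) (at x within {\<alpha>..\<beta>})" if x: "x \<in> {\<alpha>..\<beta>} - E" for x
      using x \<open>a \<le> \<alpha>\<close> \<open>\<beta> \<le> b\<close> has_vector_derivative_within_subset[OF vecd[of x], of "{\<alpha>..\<beta>}"]
      by (auto simp: h_def)
  qed
  have incr: "norm (u \<beta> - u \<alpha>) \<le> M * (F \<beta> - F \<alpha>)"
    if "a \<le> \<alpha>" "\<alpha> \<le> \<beta>" "\<beta> \<le> b" and M: "\<And>x. x \<in> {\<alpha>..\<beta>} \<Longrightarrow> norm (u x) \<le> M" for \<alpha> \<beta> M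
  proof -
    have M0: "M \<ge> 0" using order_trans[OF norm_ge_zero M[of \<alpha>]] that(2) by simp
    have ci: "c integrable_on {\<alpha>..\<beta>}"
      using that by (intro integrable_subinterval_real[OF c(1)]) auto
    have "norm (integral {\<alpha>..\<beta>} h) \<le> integral {\<alpha>..\<beta>} (\<lambda>x. M * c x)"
    proof (rule integral_norm_bound_integral)
      show "h integrable_on {\<alpha>..\<beta>}" using ftc[OF that(1-3)] by blast
      show "(\<lambda>x. M * c x) integrable_on {\<alpha>..\<beta>}" using ci by (rule integrable_on_mult_right)
      show "norm (h x) \<le> M * c x" if x: "x \<in> {\<alpha>..\<beta>}" for x
      proof (cases "x \<in> E")
        case True
        then show ?thesis using M0 c(2)[of x] x \<open>a \<le> \<alpha>\<close> \<open>\<beta> \<le> b\<close> by (simp add: h_def)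
      next
        case False
        have "norm (u' x) \<le> c x * norm (u x)" using bound[of x] x False \<open>a \<le> \<alpha>\<close> \<open>\<beta> \<le> b\<close> by simp
        also have "\<dots> \<le> c x * M"
          using M[OF x] c(2)[of x] x \<open>a \<le> \<alpha>\<close> \<open>\<beta> \<le> b\<close> by (intro mult_left_mono) auto
        finally show ?thesis using False by (simp add: h_def mult.commute)
      qed
    qed
    also have "\<dots> = M * integral {\<alpha>..\<beta>} c" by simp
    also have "integral {\<alpha>..\<beta>} c = F \<beta> - F \<alpha>"
      using Henstock_Kurzweil_Integration.integral_combine[where f = c and a = a and c = \<alpha> and b = \<beta>] that integrable_subinterval_real[OF c(1), of a \<beta>]
      by (simp add: F_def)
    finally show ?thesis using integral_unique[OF ftc[OF that(1-3)]] by simp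
  qed
  have ab: "a \<le> b" using s by auto
  have cont: "continuous_on {a..b} u"
  proof -
    have "h integrable_on {a..b}" using ftc[of a b] ab by auto
    then have "continuous_on {a..b} (\<lambda>x. u a + integral {a..x} h)"
      by (intro continuous_intros indefinite_integral_continuous_1)
    moreover have "u a + integral {a..x} h = u x" if "x \<in> {a..b}" for x
      using integral_unique[OF ftc[of a x]] that by simp
    ultimately show ?thesis by (metis (no_types, lifting) continuous_on_cong)
  qed
  have contF: "continuous_on {a..b} F"
    unfolding F_def by (rule indefinite_integral_continuous_1[OF c(1)])
  define Z where "Z = {x \<in> {a..b}. u x = 0}"
  have "openin (top_of_set {a..b}) Z"
    unfolding openin_euclidean_subtopology_iff
  proof (intro conjI ballI)
    show "Z \<subseteq> {a..b}" by (auto simp: Z_def)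
    fix x assume "x \<in> Z"
    then have x: "x \<in> {a..b}" "u x = 0" by (auto simp: Z_def)
    obtain d where d: "d > 0" "\<And>y. y \<in> {a..b} \<Longrightarrow> dist y x < d \<Longrightarrow> dist (F y) (F x) < 1/2"
      using contF x(1) unfolding continuous_on_iff by (metis half_gt_zero zero_less_one)
    define J where "J = {max a (x - d/2)..min b (x + d/2)}"
    have J: "J \<subseteq> {a..b}" "x \<in> J" "compact J"
      using x d(1) by (auto simp: J_def)
    obtain y where y: "y \<in> J" "\<And>z. z \<in> J \<Longrightarrow> norm (u z) \<le> norm (u y)"
      using continuous_attains_sup[OF J(3), of "\<lambda>x. norm (u x)"] J
        continuous_on_norm[OF continuous_on_subset[OF cont J(1)]] by blast
    have "\<bar>F y - F x\<bar> < 1/2"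
      using d y(1) J(1) by (auto simp: J_def dist_real_def)
    moreover have "norm (u y) \<le> norm (u y) * \<bar>F y - F x\<bar>"
    proof (cases "x \<le> y")
      case True
      have "norm (u y - u x) \<le> norm (u y) * (F y - F x)"
      proof (rule incr)
        show "a \<le> x" "x \<le> y" "y \<le> b" using x(1) y(1) J(1) True by auto
        show "norm (u z) \<le> norm (u y)" if "z \<in> {x..y}" for z
          using that x(1) y(1) J(2) by (intro y(2)) (auto simp: J_def)
      qed
      also have "\<dots> \<le> norm (u y) * \<bar>F y - F x\<bar>" by (intro mult_left_mono) auto
      finally show ?thesis using x(2) by simp
    next
      case False
      have "norm (u x - u y) \<le> norm (u y) * (F x - F y)"
      proof (rule incr)
        show "a \<le> y" "y \<le> x" "x \<le> b" using x(1) y(1) J(1) False by auto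
        show "norm (u z) \<le> norm (u y)" if "z \<in> {y..x}" for z
          using that x(1) y(1) J(2) by (intro y(2)) (auto simp: J_def)
      qed
      also have "\<dots> \<le> norm (u y) * \<bar>F y - F x\<bar>" by (intro mult_left_mono) auto
      finally show ?thesis using x(2) by simp
    qed
    ultimately have "norm (u y) \<le> 0"
      using mult_left_mono[of "\<bar>F y - F x\<bar>" "1/2" "norm (u y)"] norm_ge_zero[of "u y"]
      by linarith
    then have "z \<in> Z" if "z \<in> J" for z
      using y(2)[OF that] J(1) that by (auto simp: Z_def)
    moreover have "z \<in> J" if "z \<in> {a..b}" "dist z x < d/2" for z
      using that unfolding J_def dist_real_def atLeastAtMost_iff max.bounded_iff min.bounded_iff by linarith
    ultimately have "\<forall>z\<in>{a..b}. dist z x < d/2 \<longrightarrow> z \<in> Z" by blast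
    then show "\<exists>e>0. \<forall>z\<in>{a..b}. dist z x < e \<longrightarrow> z \<in> Z"
      using d(1) by (intro exI[of _ "d/2"]) auto
  qed
  moreover have "closedin (top_of_set {a..b}) Z"
    unfolding Z_def using continuous_closedin_preimage_constant[OF cont, of 0] by simp
  ultimately have "Z = {} \<or> Z = {a..b}"
    using connected_Icc[of a b] unfolding connected_clopen by blast
  moreover have "s \<in> Z" using s by (simp add: Z_def)
  ultimately have "t \<in> Z" using t by blast
  then show ?thesis by (simp add: Z_def)
qed

section \<open>The solution at zero spectral parameter\<close>

lemma zero_energy_derivatives:
  assumes "Bmat ** Y' + Qmat p q x ** Y = mat 0 ** Y"
  shows "Y' $ 1 $ 1 = of_real (q x) * Y $ 1 $ 1 - of_real (p x) * Y $ 2 $ 1"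
    and "Y' $ 2 $ 1 = - of_real (p x) * Y $ 1 $ 1 - of_real (q x) * Y $ 2 $ 1"
proof -
  have "Y' $ 2 $ 1 + (of_real (p x) * Y $ 1 $ 1 + of_real (q x) * Y $ 2 $ 1) = 0"
    and "- Y' $ 1 $ 1 + (of_real (q x) * Y $ 1 $ 1 - of_real (p x) * Y $ 2 $ 1) = 0"
    using assms by (auto simp: vec_eq_iff forall_2 matrix_matrix_mult_def sum_2 Bmat_def Qmat_def mat_def)
  then show "Y' $ 1 $ 1 = of_real (q x) * Y $ 1 $ 1 - of_real (p x) * Y $ 2 $ 1"
    and "Y' $ 2 $ 1 = - of_real (p x) * Y $ 1 $ 1 - of_real (q x) * Y $ 2 $ 1"
    by (simp_all add: algebra_simps eq_neg_iff_add_eq_0)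
qed

lemma zero_energy_solutionE:
  assumes "matrix_solution p q 0 Y"
  obtains E Y' where "negligible E"
    "\<And>x. x \<in> {0..1} - E \<Longrightarrow> (Y has_vector_derivative Y' x) (at x within {0..1})"
    "\<And>x. x \<in> {0..1} - E \<Longrightarrow>
       Y' x $ 1 $ 1 = of_real (q x) * Y x $ 1 $ 1 - of_real (p x) * Y x $ 2 $ 1"
    "\<And>x. x \<in> {0..1} - E \<Longrightarrow>
       Y' x $ 2 $ 1 = - of_real (p x) * Y x $ 1 $ 1 - of_real (q x) * Y x $ 2 $ 1"
proof -
  have "AE x in lebesgue_on {0..1}. \<exists>Y'. (Y has_vector_derivative Y') (at x within {0..1}) \<and>
        Bmat ** Y' + Qmat p q x ** Y x = mat 0 ** Y x"
    using assms unfolding matrix_solution_def by blast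
  then obtain E where E: "E \<in> null_sets (lebesgue_on {0..1})"
    "\<And>x. x \<in> {0..1} - E \<Longrightarrow> \<exists>Y'. (Y has_vector_derivative Y') (at x within {0..1}) \<and>
        Bmat ** Y' + Qmat p q x ** Y x = mat 0 ** Y x"
    by (auto elim!: AE_E3)
  define Y' where "Y' x = (SOME Y'. (Y has_vector_derivative Y') (at x within {0..1}) \<and>
        Bmat ** Y' + Qmat p q x ** Y x = mat 0 ** Y x)" for x
  have Y': "(Y has_vector_derivative Y' x) (at x within {0..1})"
    "Bmat ** Y' x + Qmat p q x ** Y x = mat 0 ** Y x" if "x \<in> {0..1} - E" for x
    using someI_ex[OF E(2)[OF that]] by (simp_all add: Y'_def)
  show thesis
  proof (rule that)
    show "negligible E"
      using E(1) by (simp add: null_sets_restrict_space negligible_iff_null_sets)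
  qed (use Y' zero_energy_derivatives[OF Y'(2)] in blast)+
qed

text \<open>
  Real and imaginary parts of the first column are encoded as one complex function \<open>z\<close> with
  components \<open>part y\<^sub>1\<close> and \<open>part y\<^sub>2\<close>. The real system then reads \<open>z' = (q - \<i> p) cnj z\<close>, hence
  \<open>norm z' = norm (q - \<i> p) * norm z\<close>, and uniqueness applies with the coefficient
  \<open>1 + p\<^sup>2 + q\<^sup>2\<close>, which dominates \<open>norm (q - \<i> p)\<close> and is integrable because \<open>p\<close> and \<open>q\<close> are square
  integrable.
\<close>

lemma zero_energy_part_vanishes:
  fixes part :: "complex \<Rightarrow> real"
  assumes part: "part = Re \<or> part = Im"
    and p: "L2_on {0..1} p" and q: "L2_on {0..1} q" and Y: "matrix_solution p q 0 Y"
    and s: "s \<in> {0..1}" "part (Y s $ 1 $ 1) = 0" "part (Y s $ 2 $ 1) = 0" and t: "t \<in> {0..1}"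
  shows "part (Y t $ 1 $ 1) = 0 \<and> part (Y t $ 2 $ 1) = 0"
proof -
  obtain E Y' where E: "negligible E"
    and vecd: "\<And>x. x \<in> {0..1} - E \<Longrightarrow> (Y has_vector_derivative Y' x) (at x within {0..1})"
    and Y': "\<And>x. x \<in> {0..1} - E \<Longrightarrow>
       Y' x $ 1 $ 1 = of_real (q x) * Y x $ 1 $ 1 - of_real (p x) * Y x $ 2 $ 1"
    "\<And>x. x \<in> {0..1} - E \<Longrightarrow>
       Y' x $ 2 $ 1 = - of_real (p x) * Y x $ 1 $ 1 - of_real (q x) * Y x $ 2 $ 1"
    using zero_energy_solutionE[OF Y] by metis
  define L :: "M2 \<Rightarrow> complex" where "L A = Complex (part (A $ 1 $ 1)) (part (A $ 2 $ 1))" for A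
  define c where "c x = 1 + (p x)\<^sup>2 + (q x)\<^sup>2" for x
  have L: "bounded_linear L"
    unfolding linear_conv_bounded_linear[symmetric]
    using part by (intro linearI) (auto simp: L_def complex_eq_iff)
  have "(\<lambda>x. (p x)\<^sup>2) integrable_on {0..1}" "(\<lambda>x. (q x)\<^sup>2) integrable_on {0..1}"
    using p q by (auto simp: L2_on_def intro!: integrable_on_lebesgue_on)
  then have c: "c integrable_on {0..1}"
    unfolding c_def by (intro integrable_add) auto
  have "L (Y t) = 0"
  proof (rule absolutely_continuous_linear_differential_inequality_zero[OF _ E])
    show "absolutely_continuous_on {0..1} (\<lambda>x. L (Y x))"
      using Y by (intro absolutely_continuous_on_bounded_linear[OF L]) (simp add: matrix_solution_def)
    show "((\<lambda>x. L (Y x)) has_vector_derivative L (Y' x)) (at x within {0..1})" if "x \<in> {0..1} - E" for x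
      by (rule bounded_linear.has_vector_derivative[OF L vecd[OF that]])
    show "norm (L (Y' x)) \<le> c x * norm (L (Y x))" if x: "x \<in> {0..1} - E" for x
    proof -
      have "L (Y' x) = Complex (q x) (- p x) * cnj (L (Y x))"
        using part by (auto simp: L_def Y'[OF x] complex_eq_iff)
      then have "norm (L (Y' x)) = norm (Complex (q x) (- p x)) * norm (L (Y x))"
        by (simp add: norm_mult)
      moreover have "norm (Complex (q x) (- p x)) \<le> c x"
      proof -
        have "(q x)\<^sup>2 + (p x)\<^sup>2 \<le> c x * 1" by (simp add: c_def)
        also have "\<dots> \<le> c x * c x" by (intro mult_left_mono) (auto simp: c_def)
        finally show ?thesis
          by (auto simp: cmod_def power2_eq_square[of "c x"] intro!: real_le_lsqrt) (simp add: c_def)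
      qed
      ultimately show ?thesis by (simp add: mult_right_mono)
    qed
    show "L (Y s) = 0" using s by (simp add: L_def complex_eq_iff)
    show "0 \<le> c x" for x by (simp add: c_def)
  qed (use c s t in auto)
  then show ?thesis by (simp add: L_def complex_eq_iff)
qed

text \<open>
  A nonzero complex vector may have \<open>y\<^sub>1\<^sup>2 + y\<^sub>2\<^sup>2 = 0\<close>, but a nonzero real one may not. Uniqueness
  is used twice: forwards from \<open>0\<close> for the imaginary parts, and backwards from \<open>x\<close> to \<open>0\<close> for the
  real parts.
\<close>

lemma zero_energy_first_column_nonisotropic:
  assumes p: "L2_on {0..1} p" and q: "L2_on {0..1} q" and Y: "matrix_solution p q 0 Y"
    and x: "x \<in> {0..1}"
  shows "(Y x $ 1 $ 1)\<^sup>2 + (Y x $ 2 $ 1)\<^sup>2 \<noteq> 0"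
proof -
  have init: "Y 0 $ 1 $ 1 = 1" "Y 0 $ 2 $ 1 = 0"
    using Y by (simp_all add: matrix_solution_def mat_def)
  have "Im (Y x $ 1 $ 1) = 0" "Im (Y x $ 2 $ 1) = 0"
    using zero_energy_part_vanishes[OF _ p q Y, of Im 0 x] init x by auto
  moreover have "Re (Y x $ 1 $ 1) \<noteq> 0 \<or> Re (Y x $ 2 $ 1) \<noteq> 0"
    using zero_energy_part_vanishes[OF _ p q Y, of Re x 0] init x by auto
  ultimately have "Re ((Y x $ 1 $ 1)\<^sup>2 + (Y x $ 2 $ 1)\<^sup>2) \<noteq> 0"
    by (simp add: power2_eq_square sum_squares_eq_zero_iff)
  then show ?thesis by (metis zero_complex.simps(1))
qed

section \<open>Recovery of the potential\<close>

lemma zero_energy_kernel_coeff: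
  assumes U: "transmutation_kernel U K" and x: "x \<in> {0..1}"
  shows "U 0 x = mat 1 + 2 *\<^sub>R kernel_coeff K 0 x"
proof -
  have "mexp (mat 0 ** Bmat) = mat 1"
    using mexp_B[of 0] by (simp add: vec_eq_iff forall_2 mat_def)
  moreover have "U 0 x = mexp (mat (- (0 * of_real x)) ** Bmat)
        + (LINT t|lebesgue_on {-x..x}. K x t ** mexp (mat (- (0 * of_real t)) ** Bmat))"
    using U x unfolding transmutation_kernel_def by blast
  ultimately show ?thesis
    by (simp add: kernel_coeff_def legendre_poly_0)
qed

text \<open>
  The matrix of the system in the unknowns \<open>p\<close> and \<open>q\<close> has orthogonal columns of squared length \<open>N\<close>,
  so up to the factor \<open>1/N\<close> its inverse is its transpose. The second form collects the products of
  the first by the product rule.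
\<close>

lemma potential_from_derivatives:
  fixes p q a b da db N :: complex
  assumes N: "N = 4 * b\<^sup>2 + (1 + 2 * a)\<^sup>2" "N \<noteq> 0"
    and da: "2 * da = q * (1 + 2 * a) - p * (2 * b)"
    and db: "2 * db = - p * (1 + 2 * a) - q * (2 * b)"
  shows "(vector [p, q] :: complex^2)
          = (1 / N) *s ((vector [vector [- 2 * b, - (1 + 2 * a)],
                                 vector [1 + 2 * a, - 2 * b]] :: complex^2^2)
                        *v vector [2 * da, 2 * db])"
    and "(vector [p, q] :: complex^2)
          = (2 / N) *s vector [- 2 * (a * db + da * b) - db, 2 * a * da - 2 * b * db + da]"
proof -
  have pN: "p * N = - 2 * b * (2 * da) + - (1 + 2 * a) * (2 * db)"
    and qN: "q * N = (1 + 2 * a) * (2 * da) + - 2 * b * (2 * db)"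
    using N(1) da db by algebra+
  have p: "p = 1 / N * (- 2 * b * (2 * da) + - (1 + 2 * a) * (2 * db))"
    and q: "q = 1 / N * ((1 + 2 * a) * (2 * da) + - 2 * b * (2 * db))"
    using pN qN by (simp_all only: times_divide_eq_left nonzero_eq_divide_eq[OF N(2)] mult_1_left)
  show "(vector [p, q] :: complex^2)
          = (1 / N) *s ((vector [vector [- 2 * b, - (1 + 2 * a)],
                                 vector [1 + 2 * a, - 2 * b]] :: complex^2^2)
                        *v vector [2 * da, 2 * db])"
    using p q by (simp only: vec_eq_iff forall_2 matrix_vector_mult_def sum_2 vector_2
      vector_smult_component vec_lambda_beta)
  have "p * N = 2 * (- 2 * (a * db + da * b) - db)" "q * N = 2 * (2 * a * da - 2 * b * db + da)"
    using pN qN by algebra+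
  then have "p = 2 / N * (- 2 * (a * db + da * b) - db)" "q = 2 / N * (2 * a * da - 2 * b * db + da)"
    by (simp_all only: times_divide_eq_left nonzero_eq_divide_eq[OF N(2)])
  then show "(vector [p, q] :: complex^2)
          = (2 / N) *s vector [- 2 * (a * db + da * b) - db, 2 * a * da - 2 * b * db + da]"
    by (simp only: vec_eq_iff forall_2 vector_2 vector_smult_component)
qed

theorem proposition5p10:
  fixes p q :: "real \<Rightarrow> real"
    and U :: "complex \<Rightarrow> real \<Rightarrow> complex^2^2"
    and K :: "real \<Rightarrow> real \<Rightarrow> complex^2^2"
    and v :: "real \<Rightarrow> complex^2"
    and a b :: "real \<Rightarrow> complex"
  assumes "L2_on {0..1} p" and "L2_on {0..1} q"
    and "\<And>lam. matrix_solution p q lam (U lam)"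
    and "transmutation_kernel U K"
    and "v = (\<lambda>x. column 1 (kernel_coeff_C K 0 x))"
    and "a = (\<lambda>x. v x $ 1)" and "b = (\<lambda>x. v x $ 2)"
  shows "AE x in lebesgue_on {0..1}.
    (let D = (\<lambda>f :: real \<Rightarrow> complex. vector_derivative f (at x within {0..1}));
         N = 4 * (b x)\<^sup>2 + (1 + 2 * a x)\<^sup>2
     in a differentiable (at x within {0..1}) \<and> b differentiable (at x within {0..1}) \<and> N \<noteq> 0 \<and>
        (vector [of_real (p x), of_real (q x)] :: complex^2)
          = (1 / N) *s ((vector [vector [- 2 * b x, - (1 + 2 * a x)],
                                 vector [1 + 2 * a x, - 2 * b x]] :: complex^2^2)
                        *v vector [2 * D a, 2 * D b]) \<and>
        (vector [of_real (p x), of_real (q x)] :: complex^2)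
          = (2 / N) *s vector [- 2 * D (\<lambda>y. a y * b y) - D b,
                               D (\<lambda>y. (a y)\<^sup>2) - D (\<lambda>y. (b y)\<^sup>2) + D a])"
proof -
  define Y where "Y = U 0"
  have Y: "matrix_solution p q 0 Y" using assms(3) by (simp add: Y_def)
  obtain E Y' where E: "negligible E"
    and vecd: "\<And>x. x \<in> {0..1} - E \<Longrightarrow> (Y has_vector_derivative Y' x) (at x within {0..1})"
    and Y': "\<And>x. x \<in> {0..1} - E \<Longrightarrow>
       Y' x $ 1 $ 1 = of_real (q x) * Y x $ 1 $ 1 - of_real (p x) * Y x $ 2 $ 1"
    "\<And>x. x \<in> {0..1} - E \<Longrightarrow>
       Y' x $ 2 $ 1 = - of_real (p x) * Y x $ 1 $ 1 - of_real (q x) * Y x $ 2 $ 1"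
    using zero_energy_solutionE[OF Y] by metis
  have ab: "Y x $ 1 $ 1 = 1 + 2 * a x" "Y x $ 2 $ 1 = 2 * b x" if "x \<in> {0..1}" for x
    using zero_energy_kernel_coeff[OF assms(4) that]
    by (simp_all add: Y_def assms(5-7) column_def kernel_coeff_C_def mat_def scaleR_conv_of_real)
  have "AE x in lebesgue_on {0..1}. x \<notin> E"
    using E by (intro AE_I'[of "E \<inter> {0..1}"])
      (auto simp: null_sets_restrict_space negligible_iff_null_sets[symmetric] negligible_Int)
  then show ?thesis
  proof (rule lebesgue_on_mono)
    fix x :: real assume "x \<notin> E" "x \<in> {0..1}"
    then have x: "x \<in> {0..1}" and xE: "x \<in> {0..1} - E" by auto
    define N where "N = 4 * (b x)\<^sup>2 + (1 + 2 * a x)\<^sup>2"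
    define da where "da = Y' x $ 1 $ 1 / 2"
    define db where "db = Y' x $ 2 $ 1 / 2"
    have "N = (Y x $ 1 $ 1)\<^sup>2 + (Y x $ 2 $ 1)\<^sup>2"
      by (simp add: N_def ab[OF x] power2_eq_square)
    then have N: "N \<noteq> 0"
      using zero_energy_first_column_nonisotropic[OF assms(1,2) Y x] by simp
    have entry: "((\<lambda>y. Y y $ i $ 1) has_vector_derivative Y' x $ i $ 1) (at x within {0..1})" for i
      by (rule bounded_linear.has_vector_derivative[OF _ vecd[OF xE]])
         (auto intro!: linearI simp: linear_conv_bounded_linear[symmetric])
    have "((\<lambda>y. (Y y $ 1 $ 1 - 1) / 2) has_vector_derivative da) (at x within {0..1})"
      unfolding da_def by (auto intro!: derivative_eq_intros entry)
    then have a: "(a has_vector_derivative da) (at x within {0..1})"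
      by (rule has_vector_derivative_transform[OF x, rotated]) (simp add: ab)
    have "((\<lambda>y. Y y $ 2 $ 1 / 2) has_vector_derivative db) (at x within {0..1})"
      unfolding db_def by (auto intro!: derivative_eq_intros entry)
    then have b: "(b has_vector_derivative db) (at x within {0..1})"
      by (rule has_vector_derivative_transform[OF x, rotated]) (simp add: ab)
    have D: "vector_derivative f (at x within {0..1}) = f'"
      if "(f has_vector_derivative f') (at x within {0..1})" for f :: "real \<Rightarrow> complex" and f'
      using vector_derivative_within_cbox[of 0 1 x f f'] x that by simp
    have ab': "((\<lambda>y. a y * b y) has_vector_derivative (a x * db + da * b x)) (at x within {0..1})"
      by (rule has_vector_derivative_mult[OF a b])
    have aa': "((\<lambda>y. (a y)\<^sup>2) has_vector_derivative (2 * a x * da)) (at x within {0..1})"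
      using has_vector_derivative_mult[OF a a] by (simp add: power2_eq_square algebra_simps)
    have bb': "((\<lambda>y. (b y)\<^sup>2) has_vector_derivative (2 * b x * db)) (at x within {0..1})"
      using has_vector_derivative_mult[OF b b] by (simp add: power2_eq_square algebra_simps)
    have da2: "2 * da = of_real (q x) * (1 + 2 * a x) - of_real (p x) * (2 * b x)"
      and db2: "2 * db = - of_real (p x) * (1 + 2 * a x) - of_real (q x) * (2 * b x)"
      using Y'[OF xE] by (simp_all add: da_def db_def ab[OF x])
    show "let D = (\<lambda>f :: real \<Rightarrow> complex. vector_derivative f (at x within {0..1}));
         N = 4 * (b x)\<^sup>2 + (1 + 2 * a x)\<^sup>2
     in a differentiable (at x within {0..1}) \<and> b differentiable (at x within {0..1}) \<and> N \<noteq> 0 \<and>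
        (vector [of_real (p x), of_real (q x)] :: complex^2)
          = (1 / N) *s ((vector [vector [- 2 * b x, - (1 + 2 * a x)],
                                 vector [1 + 2 * a x, - 2 * b x]] :: complex^2^2)
                        *v vector [2 * D a, 2 * D b]) \<and>
        (vector [of_real (p x), of_real (q x)] :: complex^2)
          = (2 / N) *s vector [- 2 * D (\<lambda>y. a y * b y) - D b,
                               D (\<lambda>y. (a y)\<^sup>2) - D (\<lambda>y. (b y)\<^sup>2) + D a]"
      unfolding Let_def N_def[symmetric] D[OF a] D[OF b] D[OF ab'] D[OF aa'] D[OF bb']
      using potential_from_derivatives[OF N_def N da2 db2] N
        differentiableI_vector[OF a] differentiableI_vector[OF b] by blast
  qed
qed

end
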